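(* Let $\eta=(\eta_1,\dots,\eta_r)$ be a composition of $n$. Then, as formal power series in $t$ with coefficients in $\mathbb{Q}(q)$, $$\frac{C_{B_{\eta}}(q,t)}{\prod_{i=0}^n(1-q^i t)} = \sum_{k\geq 0} \left( \prod_{i=1}^r \sum_{j= 0}^{\eta_i} q^{\frac{j(j-1)}{2}} \binom{\eta_i}{j}_q \binom{k-j+\eta_i}{\eta_i}_q \right) t^k= \mathrm{Ehr}_{\lozenge_{\eta}, \bar{\boldsymbol{\mu}}_{\eta}}(q,t).$$
   Context: $S_\eta$ is the set of multiset permutations $w=w_1\dots w_n$ of the multiset with $\eta_j$ copies of $j$, $j\in[r]$. $B_\eta$ is the set of signed multiset permutations: pairs $(w,\epsilon)$ with $w\in S_\eta$ and $\epsilon:[n]\to\{\pm1\}$ (written as $w_1^{\pm}\dots w_n^{\pm}$ with the sign $\epsilon(i)$ on $w_i$). The standardisation $\mathrm{std}(w)\in S_n$ of $w\in S_\eta$ replaces the $\eta_1$ ones from left to right by $1,\dots,\eta_1$, the $\eta_2$ twos from left to right by $\eta_1+1,\dots,\eta_1+\eta_2$, etc.; for $(w,\epsilon)$ put $\mathrm{std}(w,\epsilon)=(\mathrm{std}(w),\epsilon)$, viewed as the sequence of integers $\epsilon(i)\,\mathrm{std}(w)_i$. The descent set is $\mathrm{Des}(w,\epsilon)=\{i\in\{0,1,\dots,n-1\}: \mathrm{std}(w,\epsilon)_i>\mathrm{std}(w,\epsilon)_{i+1}\}$ with $\mathrm{std}(w,\epsilon)_0:=0$ (comparisons in the usual order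 of $\mathbb{Z}$); $\mathrm{maj}=\sum_{i\in\mathrm{Des}} i$, $\mathrm{des}=|\mathrm{Des}|$, and $C_{B_\eta}(q,t)=\sum_{w\in B_\eta}q^{\mathrm{maj}(w)}t^{\mathrm{des}(w)}$. The $q$-binomial is $\binom{m}{j}_q=\frac{[m]_q!}{[m-j]_q![j]_q!}$, $[m]_q=\frac{1-q^m}{1-q}$ (and $\binom{m}{j}_q=0$ when $m<j$, $m\ge0$ as needed). The cross polytope is $\lozenge_m=\{x\in\mathbb{R}^m:|x_1|+\dots+|x_m|\le1\}$ and $\lozenge_\eta=\lozenge_{\eta_1}\times\dots\times\lozenge_{\eta_r}\subset\mathbb{R}^n$. For $k\ge0$ and $y\in k\Delta_m\cap\mathbb{Z}^m$ (where $\Delta_m=\{y\ge0,\sum y_i\le1\}$) let $\mu_{k,m}(y)=\sum_{i=1}^m\bigl(k-\sum_{l=i}^m y_l\bigr)$. For $x=(x_1,\dots,x_r)\in k\lozenge_\eta\cap\mathbb{Z}^n$ with $x_i\in k\lozenge_{\eta_i}$ set $\bar\mu_{k,\eta}(x)=\sum_{i=1}^r\mu_{k,\eta_i}(|x_i|)$, where $|\cdot|$ is the coordinatewise absolute value. Then $\mathrm{Ehr}_{\lozenge_\eta,\bar{\boldsymbol\mu}_\eta}(q,t)=\sum_{k\ge0}\sum_{x\in k\lozenge_\eta\cap\mathbb{Z}^n}q^{\bar\mu_{k,\eta}(x)}t^k$. *)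

theory Defs
  imports
    Complex_Main
    "HOL-Combinatorics.Multiset_Permutations"
    "HOL-Computational_Algebra.Formal_Power_Series"
    "HOL-Computational_Algebra.Fraction_Field"
    "HOL-Computational_Algebra.Polynomial"
begin

definition qv :: "rat poly fract" where
  "qv = Fract [:0, 1:] 1"

definition q_int :: "nat \<Rightarrow> rat poly fract" where
  "q_int m = (1 - qv ^ m) / (1 - qv)"

definition q_fact :: "nat \<Rightarrow> rat poly fract" where
  "q_fact m = (\<Prod>i = 1..m. q_int i)"

definition q_binom :: "nat \<Rightarrow> nat \<Rightarrow> rat poly fract" where
  "q_binom m j = (if j \<le> m then q_fact m / (q_fact (m - j) * q_fact j) else 0)"

text \<open>The composition \<open>\<eta> = (\<eta>\<^sub>1, \<dots>, \<eta>\<^sub>r)\<close> is a list, so \<open>\<eta>\<^sub>j\<close> is \<open>\<eta> ! (j - 1)\<close>;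
  the letters of the words are \<open>1, \<dots>, r\<close>.\<close>

definition S_eta :: "nat list \<Rightarrow> nat list set" where
  "S_eta \<eta> = permutations_of_multiset (\<Sum>j = 1..length \<eta>. replicate_mset (\<eta> ! (j - 1)) j)"

definition B_eta :: "nat list \<Rightarrow> (nat list \<times> int list) set" where
  "B_eta \<eta> = {(w, \<epsilon>). w \<in> S_eta \<eta> \<and> length \<epsilon> = length w \<and> set \<epsilon> \<subseteq> {1, -1}}"

text \<open>The \<open>c\<close>-th occurrence from the left of the letter \<open>j\<close> is replaced by
  \<open>\<eta>\<^sub>1 + \<dots> + \<eta>\<^bsub>j-1\<^esub> + c\<close>.\<close>

definition std :: "nat list \<Rightarrow> nat list \<Rightarrow> nat list" where
  "std \<eta> w = map (\<lambda>i. sum_list (take (w ! i - 1) \<eta>) + count_list (take (Suc i) w) (w ! i))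
                 [0..<length w]"

text \<open>The leading \<open>0\<close> is the convention for the entry at position \<open>0\<close>, so that list index \<open>i\<close>
  is position \<open>i\<close> of the signed permutation.\<close>

definition signed_std :: "nat list \<Rightarrow> nat list \<times> int list \<Rightarrow> int list" where
  "signed_std \<eta> = (\<lambda>(w, \<epsilon>). 0 # map2 (\<lambda>s v. s * int v) \<epsilon> (std \<eta> w))"

definition Des :: "nat list \<Rightarrow> nat list \<times> int list \<Rightarrow> nat set" where
  "Des \<eta> x = {i. i < length (fst x) \<and> signed_std \<eta> x ! i > signed_std \<eta> x ! (i + 1)}"

definition maj :: "nat list \<Rightarrow> nat list \<times> int list \<Rightarrow> nat" where
  "maj \<eta> x = \<Sum> (Des \<eta> x)"

definition des :: "nat list \<Rightarrow> nat list \<times> int list \<Rightarrow> nat" where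
  "des \<eta> x = card (Des \<eta> x)"

definition C_B :: "nat list \<Rightarrow> rat poly fract fps" where
  "C_B \<eta> = (\<Sum>x\<in>B_eta \<eta>. fps_const (qv ^ maj \<eta> x) * fps_X ^ des \<eta> x)"

text \<open>A point of \<open>\<real>\<^sup>m\<close> is a list of length \<open>m\<close>, and a point of
  \<open>\<real>\<^sup>n = \<real>\<^bsup>\<eta>\<^sub>1\<^esup> \<times> \<dots> \<times> \<real>\<^bsup>\<eta>\<^sub>r\<^esup>\<close> is the list of its \<open>r\<close> blocks.\<close>

definition cross_polytope :: "nat \<Rightarrow> real list set" where
  "cross_polytope m = {x. length x = m \<and> (\<Sum>i<m. \<bar>x ! i\<bar>) \<le> 1}"

definition cross_polytope_prod :: "nat list \<Rightarrow> real list list set" where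
  "cross_polytope_prod \<eta> =
     {x. length x = length \<eta> \<and> (\<forall>i<length \<eta>. x ! i \<in> cross_polytope (\<eta> ! i))}"

definition dilate :: "nat \<Rightarrow> real list list set \<Rightarrow> real list list set" where
  "dilate k P = map (map (\<lambda>c. real k * c)) ` P"

definition lattice_points :: "real list list set \<Rightarrow> int list list set" where
  "lattice_points P = {x. map (map real_of_int) x \<in> P}"

definition mu :: "nat \<Rightarrow> nat \<Rightarrow> int list \<Rightarrow> int" where
  "mu k m y = (\<Sum>i<m. int k - (\<Sum>l = i..<m. y ! l))"

definition mu_bar :: "nat \<Rightarrow> nat list \<Rightarrow> int list list \<Rightarrow> int" where
  "mu_bar k \<eta> x = (\<Sum>i<length \<eta>. mu k (\<eta> ! i) (map abs (x ! i)))"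

definition Ehr :: "nat list \<Rightarrow> rat poly fract fps" where
  "Ehr \<eta> = Abs_fps (\<lambda>k. \<Sum>x\<in>lattice_points (dilate k (cross_polytope_prod \<eta>)). qv powi mu_bar k \<eta> x)"

end

theory Submission
  imports Defs "HOL-Library.Product_Lexorder"
begin

text \<open>Expanding \<open>1 / \<Prod>\<^sub>i (1 - q\<^sup>i t)\<close> turns a signed word \<open>x\<close> with descent set \<open>D\<close> into the sequences
  \<open>k = a\<^sub>0 \<ge> a\<^sub>1 \<ge> \<dots> \<ge> a\<^sub>n \<ge> 0\<close> that drop strictly after every position in \<open>D\<close>, weighted by
  \<open>q\<close> to the power \<open>a\<^sub>1 + \<dots> + a\<^sub>n\<close> and \<open>t\<^sup>k\<close>. On the signed letters \<open>s\<^sub>i = \<epsilon>\<^sub>i w\<^sub>i\<close> a descent means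
  \<open>s\<^sub>i > s\<^bsub>i+1\<^esub>\<close> or \<open>s\<^sub>i = s\<^bsub>i+1\<^esub> < 0\<close>, so such a sequence together with the word is a lexicographically
  sorted list of pairs \<open>(-a\<^sub>i, s\<^sub>i)\<close> above \<open>(-k, 0)\<close> in which only pairs with a positive letter may repeat.
  Sorted lists are multisets, so the count factors over the letters: the letter \<open>j\<close> contributes the
  coefficient of \<open>z\<close> to the power \<open>\<eta>\<^sub>j\<close> in
  \<open>\<Prod>\<^bsub>a<k\<^esub> (1 + q\<^sup>a z) / \<Prod>\<^bsub>a\<le>k\<^esub> (1 - q\<^sup>a z)\<close>.
  The two \<open>q\<close>-binomial theorems expand this coefficient into the stated sum, and slicing the cross
  polytope by its last coordinate gives the same recursion in \<open>\<eta>\<^sub>j\<close> for the weighted lattice points.\<close>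

unbundle fps_syntax

section \<open>Sorted words over a coloured alphabet\<close>

text \<open>Such a list stands for the multiset of its entries, in which only letters satisfying
  \<open>rep\<close> may occur more than once; \<open>c\<close> prescribes how many letters of each
  colour there are.\<close>

definition sorted_words ::
    "('a::linorder \<Rightarrow> bool) \<Rightarrow> ('a \<Rightarrow> nat) \<Rightarrow> 'a set \<Rightarrow> (nat \<Rightarrow> nat) \<Rightarrow> 'a list set" where
  "sorted_words rep col A c =
     {xs. set xs \<subseteq> A \<and> sorted_wrt (\<lambda>x y. x < y \<or> x = y \<and> rep x) xs
        \<and> (\<forall>j. length (filter (\<lambda>x. col x = j) xs) = c j)}"

lemma sorted_words_empty:
  "sorted_words rep col {} c = (if \<forall>j. c j = 0 then {[]} else {})"
  by (auto simp: sorted_words_def)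

text \<open>A minimal letter \<open>b\<close> can only occur at the front. Taking off one copy
  leaves the alphabet unchanged if \<open>b\<close> may recur, and removes \<open>b\<close> from it
  otherwise.\<close>

lemma sorted_words_insert:
  assumes b: "\<forall>a\<in>A. b < a"
  shows "sorted_words rep col (insert b A) c =
    sorted_words rep col A c \<union>
    (if c (col b) = 0 then {}
     else (#) b ` sorted_words rep col (if rep b then insert b A else A)
                    (c(col b := c (col b) - 1)))" (is "?L = ?R")
proof (intro equalityI subsetI)
  fix xs assume xs: "xs \<in> ?L"
  show "xs \<in> ?R"
  proof (cases xs)
    case Nil
    with xs show ?thesis by (simp add: sorted_words_def)
  next
    case (Cons x ys)
    show ?thesis
    proof (cases "x = b")
      case True
      have "c (col b) \<noteq> 0"
        using xs Cons True by (auto simp: sorted_words_def dest: spec[where x = "col b"])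
      moreover have "ys \<in> sorted_words rep col (if rep b then insert b A else A)
                            (c(col b := c (col b) - 1))"
        using xs Cons True
        by (auto simp: sorted_words_def split: if_splits dest: spec[where x = "col b"])
      ultimately show ?thesis using Cons True by auto
    next
      case False
      then have "x \<in> A" using xs Cons by (auto simp: sorted_words_def)
      then have "b \<notin> set xs"
        using xs Cons b by (fastforce simp: sorted_words_def)
      then show ?thesis using xs by (auto simp: sorted_words_def)
    qed
  qed
next
  fix xs assume xs: "xs \<in> ?R"
  then consider "xs \<in> sorted_words rep col A c"
    | ys where "c (col b) \<noteq> 0" "xs = b # ys"
        "ys \<in> sorted_words rep col (if rep b then insert b A else A)
                    (c(col b := c (col b) - 1))"
    by (auto split: if_splits)
  then show "xs \<in> ?L"
  proof cases
    case 1
    then show ?thesis by (auto simp: sorted_words_def)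
  next
    case 2
    then show ?thesis using b
      by (auto simp: sorted_words_def split: if_splits)
  qed
qed

text \<open>The exponent of \<open>fps_X\<close> records the multiplicity of the letter: arbitrary
  if it is repeatable, at most one otherwise.\<close>

definition letter_fps :: "('a \<Rightarrow> bool) \<Rightarrow> ('a \<Rightarrow> 'b::field) \<Rightarrow> 'a \<Rightarrow> 'b fps" where
  "letter_fps rep wt x =
     (if rep x then inverse (1 - fps_const (wt x) * fps_X) else 1 + fps_const (wt x) * fps_X)"

lemma geometric_fps_step:
  fixes P :: "'b::field fps"
  shows "inverse (1 - fps_const w * fps_X) * P
       = P + fps_const w * fps_X * (inverse (1 - fps_const w * fps_X) * P)"
proof -
  define a where "a = fps_const w * fps_X"
  define I where "I = inverse (1 - a)"
  have "I * (1 - a) = 1"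
    unfolding I_def a_def by (rule inverse_mult_eq_1) simp
  then have "I = 1 + a * I" by (simp add: right_diff_distrib mult.commute diff_eq_eq)
  then have "I * P = (1 + a * I) * P" by (rule arg_cong)
  also have "\<dots> = P + a * (I * P)" by (simp add: distrib_right mult.assoc)
  finally show ?thesis unfolding I_def a_def .
qed

text \<open>Coefficient form of the splitting in \<open>sorted_words_insert\<close>: words without
  the new letter, plus words from which one copy of it has been taken off.\<close>

lemma letter_fps_mult_nth:
  "(letter_fps rep wt x * P) $ m = P $ m +
     (if m = 0 then 0 else wt x * (if rep x then letter_fps rep wt x * P else P) $ (m - 1))"
proof -
  have *: "letter_fps rep wt x * P =
      P + fps_const (wt x) * fps_X * (if rep x then letter_fps rep wt x * P else P)"
  proof (cases "rep x")
    case True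
    then show ?thesis using geometric_fps_step[of "wt x" P] by (simp add: letter_fps_def)
  next
    case False
    then show ?thesis by (simp add: letter_fps_def distrib_right)
  qed
  show ?thesis by (subst *) (simp add: mult.assoc)
qed

text \<open>A sorted list amounts to an independent choice of multiplicity for each letter, so the
  generating function is a product over letters, grouped here by colour. The induction adds letters
  from the largest down, each one minimal when it enters.\<close>

theorem sum_sorted_words:
  fixes wt :: "'a::linorder \<Rightarrow> 'b::field"
  assumes "finite J" and "finite A" and "col ` A \<subseteq> J" and "\<And>j. j \<notin> J \<Longrightarrow> c j = 0"
  shows "finite (sorted_words rep col A c) \<and>
    (\<Sum>xs\<in>sorted_words rep col A c. \<Prod>x\<leftarrow>xs. wt x) =
    (\<Prod>j\<in>J. (\<Prod>x\<in>{x\<in>A. col x = j}. letter_fps rep wt x) $ c j)"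
  using assms(2-)
proof (induction A arbitrary: c rule: finite_linorder_min_induct)
  case empty
  show ?case
  proof (cases "\<forall>j. c j = 0")
    case True
    then show ?thesis by (simp add: sorted_words_empty)
  next
    case False
    then obtain j where "j \<in> J" "c j \<noteq> 0" using empty by blast
    then show ?thesis using False \<open>finite J\<close>
      by (auto simp: sorted_words_empty intro!: prod_zero[symmetric] bexI[of _ j])
  qed
next
  case (insert b A)
  define P where "P A j = (\<Prod>x\<in>{x\<in>A. col x = j}. letter_fps rep wt x)" for A j
  define j0 where "j0 = col b"
  have j0: "j0 \<in> J" using insert.prems by (auto simp: j0_def)
  have bA: "b \<notin> A" using insert.hyps by auto
  have Pj0: "P (insert b A) j0 = letter_fps rep wt b * P A j0"
  proof -
    have "{x \<in> insert b A. col x = j0} = insert b {x\<in>A. col x = j0}" by (auto simp: j0_def)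
    then show ?thesis using insert.hyps bA by (simp add: P_def)
  qed
  have Pother: "P (insert b A) j = P A j" if "j \<noteq> j0" for j
    unfolding P_def by (rule prod.cong) (use that in \<open>auto simp: j0_def\<close>)
  define W where "W A c = sorted_words rep col A c" for A c
  define S where "S A c = (\<Sum>xs\<in>W A c. \<Prod>x\<leftarrow>xs. wt x)" for A c
  have IH: "finite (W A c) \<and> S A c = (\<Prod>j\<in>J. P A j $ c j)"
    if "\<And>j. j \<notin> J \<Longrightarrow> c j = 0" for c
    using insert.IH[of c] insert.prems that by (auto simp: W_def S_def P_def)
  let ?A = "if rep b then insert b A else A"
  have split: "W (insert b A) c = W A c \<union> (if c j0 = 0 then {}
                 else (#) b ` W ?A (c(j0 := c j0 - 1)))" for c
    unfolding W_def j0_def by (rule sorted_words_insert) (use insert.hyps in auto)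
  have disj: "W A c \<inter> (#) b ` X = {}" for c X
    using bA by (auto simp: W_def sorted_words_def)
  \<comment> \<open>Removing one copy of a repeatable \<open>b\<close> does not shrink the alphabet,
    so the hypothesis for \<open>A\<close> alone is not enough; the falling count of the colour of
    \<open>b\<close> carries an inner induction.\<close>
  have main: "finite (W (insert b A) c) \<and> S (insert b A) c = (\<Prod>j\<in>J. P (insert b A) j $ c j)"
    if "\<And>j. j \<notin> J \<Longrightarrow> c j = 0" for c
    using that
  proof (induction "c j0" arbitrary: c rule: less_induct)
    case less
    have IHc: "finite (W A c)" "S A c = (\<Prod>j\<in>J. P A j $ c j)" using IH[of c] less.prems by auto
    have rest: "(\<Prod>j\<in>J-{j0}. P (insert b A) j $ c j) = (\<Prod>j\<in>J-{j0}. P A j $ c j)"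
      by (rule prod.cong) (auto simp: Pother)
    show ?case
    proof (cases "c j0 = 0")
      case True
      have "S (insert b A) c = S A c" unfolding S_def using split[of c] True by simp
      moreover have "P (insert b A) j0 $ 0 = P A j0 $ 0"
        unfolding Pj0 by (subst letter_fps_mult_nth) simp
      ultimately show ?thesis using IHc split[of c] True rest j0 \<open>finite J\<close>
        by (simp add: prod.remove)
    next
      case False
      define c' where "c' = c(j0 := c j0 - 1)"
      have c': "\<And>j. j \<notin> J \<Longrightarrow> c' j = 0" using less.prems j0 by (auto simp: c'_def)
      have sub: "finite (W ?A c') \<and> S ?A c' = (\<Prod>j\<in>J. P ?A j $ c' j)"
        using IH[of c'] less.hyps[of c'] c' False by (auto simp: c'_def)
      have eq: "W (insert b A) c = W A c \<union> (#) b ` W ?A c'"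
        using split[of c] False by (simp add: c'_def)
      have "S (insert b A) c = S A c + (\<Sum>xs\<in>(#) b ` W ?A c'. \<Prod>x\<leftarrow>xs. wt x)"
        unfolding S_def eq by (rule sum.union_disjoint) (use IHc sub disj in auto)
      also have "(\<Sum>xs\<in>(#) b ` W ?A c'. \<Prod>x\<leftarrow>xs. wt x) = wt b * S ?A c'"
        unfolding S_def by (subst sum.reindex) (auto simp: sum_distrib_left)
      also have "S ?A c' = P ?A j0 $ (c j0 - 1) * (\<Prod>j\<in>J-{j0}. P A j $ c j)"
      proof -
        have "(\<Prod>j\<in>J-{j0}. P ?A j $ c' j) = (\<Prod>j\<in>J-{j0}. P A j $ c j)"
          by (rule prod.cong) (auto simp: Pother c'_def)
        then show ?thesis using sub j0 \<open>finite J\<close> by (simp add: prod.remove c'_def)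
      qed
      also have "S A c = P A j0 $ c j0 * (\<Prod>j\<in>J-{j0}. P A j $ c j)"
        using IHc j0 \<open>finite J\<close> by (simp add: prod.remove)
      also have "P A j0 $ c j0 * (\<Prod>j\<in>J-{j0}. P A j $ c j) +
          wt b * (P ?A j0 $ (c j0 - 1) * (\<Prod>j\<in>J-{j0}. P A j $ c j))
        = P (insert b A) j0 $ c j0 * (\<Prod>j\<in>J-{j0}. P A j $ c j)"
        using letter_fps_mult_nth[of rep wt b "P A j0" "c j0"] False
        by (simp add: Pj0 algebra_simps)
      also have "\<dots> = (\<Prod>j\<in>J. P (insert b A) j $ c j)"
        using rest j0 \<open>finite J\<close> by (simp add: prod.remove)
      finally show ?thesis using IHc sub by (simp add: eq)
    qed
  qed
  show ?case using main[of c] insert.prems by (simp add: W_def S_def P_def)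
qed

lemma fps_mult_one_minus_nth:
  fixes F :: "'b::comm_ring_1 fps"
  shows "(F * (1 - fps_const c * fps_X)) $ m = F $ m - (if m = 0 then 0 else c * F $ (m - 1))"
  by (simp add: right_diff_distrib mult.left_commute[of F])

section \<open>Chains with prescribed strict steps\<close>

text \<open>The bound \<open>k\<close> is put in front as entry 0, so that a strict position 0
  compares the first entry with \<open>k\<close>. These are bounded P-partitions of a chain whose
  strict relations are given by \<open>D\<close>.\<close>

definition chains :: "nat \<Rightarrow> nat set \<Rightarrow> nat \<Rightarrow> nat list set" where
  "chains n D k = {a. length a = n \<and>
     (\<forall>i<n. (k # a) ! Suc i \<le> (k # a) ! i \<and> (i \<in> D \<longrightarrow> (k # a) ! Suc i < (k # a) ! i))}"

lemma chains_0: "chains 0 D k = {[]}"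
  by (auto simp: chains_def)

text \<open>The first entry becomes the upper bound of the remaining chain, whose strict positions
  shift down by one.\<close>

lemma chains_Suc:
  "chains (Suc n) D k =
     (\<Union>c\<in>{c. c \<le> k \<and> (0 \<in> D \<longrightarrow> c < k)}. (#) c ` chains n {i. Suc i \<in> D} c)"
proof -
  have "c # a \<in> chains (Suc n) D k \<longleftrightarrow>
      c \<le> k \<and> (0 \<in> D \<longrightarrow> c < k) \<and> a \<in> chains n {i. Suc i \<in> D} c" for c a
    unfolding chains_def by (auto simp: All_less_Suc2)
  moreover have "xs \<in> chains (Suc n) D k \<Longrightarrow> \<exists>c a. xs = c # a" for xs
    by (cases xs) (auto simp: chains_def)
  ultimately show ?thesis by (auto simp: image_iff) blast
qed

lemma finite_chains: "finite (chains n D k)"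
proof (induction n arbitrary: D k)
  case (Suc n)
  have "finite {c. c \<le> k \<and> (0 \<in> D \<longrightarrow> c < k)}"
    by (rule finite_subset[of _ "{..k}"]) auto
  then show ?case using Suc by (simp add: chains_Suc)
qed (simp add: chains_0)

lemma sum_chains_Suc:
  fixes q :: "'b::field"
  shows "(\<Sum>a\<in>chains (Suc n) D k. q ^ sum_list a) =
    (\<Sum>c | c \<le> k \<and> (0 \<in> D \<longrightarrow> c < k). q ^ c * (\<Sum>a\<in>chains n {i. Suc i \<in> D} c. q ^ sum_list a))"
proof -
  have "finite {c. c \<le> k \<and> (0 \<in> D \<longrightarrow> c < k)}"
    by (rule finite_subset[of _ "{..k}"]) auto
  then show ?thesis
    unfolding chains_Suc
    by (subst sum.UNION_disjoint)
       (auto simp: finite_chains sum.reindex sum_distrib_left power_add intro!: sum.cong)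
qed

text \<open>The parameter \<open>s\<close> replaces the substitution of \<open>q\<^sup>s t\<close> for \<open>t\<close>.\<close>

lemma chains_fps:
  fixes q :: "'b::field"
  assumes "D \<subseteq> {..<n}"
  shows "Abs_fps (\<lambda>k. q ^ (s * k) * (\<Sum>a\<in>chains n D k. q ^ sum_list a)) *
           (\<Prod>i = 0..n. 1 - fps_const (q ^ (i + s)) * fps_X) =
         (\<Prod>i\<in>D. fps_const (q ^ (i + s)) * fps_X)"
  using assms
proof (induction n arbitrary: D s)
  case 0
  have "Abs_fps (\<lambda>k. q ^ (s * k)) * (1 - fps_const (q ^ s) * fps_X) = 1"
  proof (rule fps_ext)
    fix m
    show "(Abs_fps (\<lambda>k. q ^ (s * k)) * (1 - fps_const (q ^ s) * fps_X)) $ m = 1 $ m"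
      by (cases m) (simp_all add: fps_mult_one_minus_nth power_add)
  qed
  then show ?case using 0 by (simp add: chains_0)
next
  case (Suc n)
  define D' where "D' = {i. Suc i \<in> D}"
  define G where "G k = (\<Sum>a\<in>chains n D' k. q ^ sum_list a)" for k
  have IH: "Abs_fps (\<lambda>k. q ^ (Suc s * k) * G k) *
      (\<Prod>i = 0..n. 1 - fps_const (q ^ (i + Suc s)) * fps_X) =
      (\<Prod>i\<in>D'. fps_const (q ^ (i + Suc s)) * fps_X)"
    unfolding G_def by (rule Suc.IH) (use Suc.prems in \<open>auto simp: D'_def\<close>)
  have sets: "{c. c \<le> k \<and> (0 \<in> D \<longrightarrow> c < k)} = (if 0 \<in> D then {..<k} else {..k})" for k :: nat
    by auto
  define d where "d = (if 0 \<in> D then fps_const (q ^ s) * fps_X else 1 :: 'b fps)"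
  have sumG: "(\<Sum>a\<in>chains (Suc n) D k. q ^ sum_list a) =
      (\<Sum>c\<in>(if 0 \<in> D then {..<k} else {..k}). q ^ c * G c)" for k
    unfolding sum_chains_Suc G_def D'_def sets ..
  let ?G = "Abs_fps (\<lambda>k. q ^ (s * k) * (\<Sum>a\<in>chains (Suc n) D k. q ^ sum_list a))"
  \<comment> \<open>Multiplying by \<open>1 - q^s t\<close> telescopes the sum over the first entry
    to its last term, with entry \<open>k\<close>, or \<open>k - 1\<close> if position 0 is strict;
    the latter costs the factor \<open>d\<close>. The weight of that entry raises \<open>s\<close>
    by one.\<close>
  have step: "?G * (1 - fps_const (q ^ s) * fps_X) = d * Abs_fps (\<lambda>k. q ^ (Suc s * k) * G k)"
  proof (rule fps_ext)
    fix m
    show "(?G * (1 - fps_const (q ^ s) * fps_X)) $ m =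
        (d * Abs_fps (\<lambda>k. q ^ (Suc s * k) * G k)) $ m"
      by (cases m; cases "0 \<in> D")
         (simp_all add: fps_mult_one_minus_nth mult.assoc sumG d_def power_add lessThan_Suc atMost_Suc
          distrib_left)
  qed
  have den: "(\<Prod>i = 0..Suc n. 1 - fps_const (q ^ (i + s)) * fps_X) =
     (1 - fps_const (q ^ s) * fps_X) * (\<Prod>i = 0..n. 1 - fps_const (q ^ (i + Suc s)) * fps_X)"
    by (simp add: prod.atLeast0_atMost_Suc_shift del: prod.cl_ivl_Suc)
  have fin: "finite D'" using Suc.prems finite_subset[of D' "{..<n}"] by (auto simp: D'_def)
  have D: "D = (if 0 \<in> D then insert 0 (Suc ` D') else Suc ` D')"
  proof (rule set_eqI)
    fix i show "i \<in> D \<longleftrightarrow> i \<in> (if 0 \<in> D then insert 0 (Suc ` D') else Suc ` D')"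
      by (cases i) (auto simp: D'_def)
  qed
  have num: "(\<Prod>i\<in>D. fps_const (q ^ (i + s)) * fps_X) =
      d * (\<Prod>i\<in>D'. fps_const (q ^ (i + Suc s)) * fps_X)"
    by (subst D) (simp add: d_def fin prod.reindex)
  show ?case unfolding den num IH[symmetric] mult.assoc[symmetric] step by (simp add: mult.assoc)
qed

section \<open>The q-binomial theorems\<close>

lemma qv_power: "qv ^ m = Fract ([:0, 1:] ^ m) 1"
  by (induction m) (simp_all add: qv_def One_fract_def)

text \<open>Comparing degrees shows that q is not a root of unity, so that q-factorials are
  invertible.\<close>

lemma qv_power_neq_1: "0 < m \<Longrightarrow> qv ^ m \<noteq> 1"
proof
  assume m: "0 < m" "qv ^ m = 1"
  then have "([:0, 1:] :: rat poly) ^ m = 1"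
    by (simp add: qv_power One_fract_def eq_fract)
  then have "degree (([:0, 1:] :: rat poly) ^ m) = 0" by simp
  then show False using m by (simp add: degree_power_eq)
qed

lemma qv_nonzero: "qv \<noteq> 0"
  by (simp add: qv_def Zero_fract_def eq_fract)

lemma q_int_nonzero: "0 < m \<Longrightarrow> q_int m \<noteq> 0"
  using qv_power_neq_1[of m] qv_power_neq_1[of 1] by (simp add: q_int_def)

lemma q_int_add: "q_int (a + b) = q_int a + qv ^ a * q_int b"
proof -
  have "1 - qv ^ (a + b) = (1 - qv ^ a) + qv ^ a * (1 - qv ^ b)"
    by (simp add: power_add right_diff_distrib)
  then show ?thesis by (simp only: q_int_def add_divide_distrib times_divide_eq_right)
qed

lemma q_fact_0: "q_fact 0 = 1"
  and q_fact_Suc: "q_fact (Suc m) = q_int (Suc m) * q_fact m"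
  by (simp_all add: q_fact_def)

lemma q_fact_nonzero: "q_fact m \<noteq> 0"
  by (simp add: q_fact_def q_int_nonzero)

lemma q_binom_0: "q_binom m 0 = 1"
  and q_binom_self: "q_binom m m = 1"
  using q_fact_nonzero[of m] by (simp_all add: q_binom_def q_fact_0)

text \<open>The q-Pascal rule: split \<open>[m+1] = [m-j] + q^(m-j) [j+1]\<close> in the numerator.
  For \<open>m \<le> j\<close> it rests on the default value 0 of \<open>q_binom\<close>.\<close>

lemma q_binom_Suc_Suc:
  "q_binom (Suc m) (Suc j) = q_binom m (Suc j) + qv ^ (m - j) * q_binom m j"
proof (cases "j < m")
  case True
  then obtain d where d: "m = j + Suc d" using less_imp_Suc_add[OF True] by auto
  have nz: "q_int (Suc d) \<noteq> 0" "q_int (Suc j) \<noteq> 0" "q_fact d \<noteq> 0" "q_fact j \<noteq> 0"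
    by (simp_all add: q_int_nonzero q_fact_nonzero)
  have "q_int (Suc m) = q_int (Suc d) + qv ^ Suc d * q_int (Suc j)"
    using q_int_add[of "Suc d" "Suc j"] d by (simp add: add_ac)
  then have b1: "q_binom (Suc m) (Suc j) =
      (q_int (Suc d) + qv ^ Suc d * q_int (Suc j)) * q_fact m /
      (q_int (Suc d) * q_fact d * (q_int (Suc j) * q_fact j))"
    using d by (simp add: q_binom_def q_fact_Suc)
  have b2: "q_binom m (Suc j) = q_fact m / (q_fact d * (q_int (Suc j) * q_fact j))"
    and b3: "q_binom m j = q_fact m / (q_int (Suc d) * q_fact d * q_fact j)"
    using d by (simp_all add: q_binom_def q_fact_Suc)
  have b4: "m - j = Suc d" using d by simp
  show ?thesis unfolding b1 b2 b3 b4 using nz by (simp add: field_simps del: power_Suc)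
next
  case False
  have "q_binom m (Suc j) = 0" using False by (simp add: q_binom_def)
  moreover have "q_binom (Suc m) (Suc j) = qv ^ (m - j) * q_binom m j"
  proof (cases "j = m")
    case True
    then show ?thesis by (simp add: q_binom_self)
  next
    case ne: False
    then show ?thesis using False by (simp add: q_binom_def)
  qed
  ultimately show ?thesis by simp
qed

lemma triangular_exponent: "Suc i * (Suc i - 1) div 2 = i + i * (i - 1) div 2"
  by (cases i) simp_all

text \<open>The last factor \<open>1 + q^k z\<close> gives a recursion for the coefficients that is
  the q-Pascal rule.\<close>

lemma q_binomial_theorem:
  "(\<Prod>a<k. 1 + fps_const (qv ^ a) * fps_X) $ i = qv ^ (i * (i - 1) div 2) * q_binom k i"
proof (induction k arbitrary: i)
  case 0
  then show ?case by (cases i) (simp_all add: q_binom_0, simp add: q_binom_def)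
next
  case (Suc k)
  let ?P = "\<Prod>a<k. 1 + fps_const (qv ^ a) * fps_X"
  have nth: "(\<Prod>a<Suc k. 1 + fps_const (qv ^ a) * fps_X) $ i =
      ?P $ i + (if i = 0 then 0 else qv ^ k * ?P $ (i - 1))" for i
    by (simp add: distrib_left mult.left_commute[of ?P])
  show ?case
  proof (cases i)
    case 0
    then show ?thesis by (simp add: nth Suc.IH q_binom_0)
  next
    case (Suc l)
    \<comment> \<open>The exponents agree only for \<open>l \<le> k\<close>, because
      \<open>k - l\<close> is truncated; otherwise \<open>q_binom k l\<close> is 0.\<close>
    have "qv ^ k * (qv ^ (l * (l - 1) div 2) * q_binom k l) =
        qv ^ (Suc l * (Suc l - 1) div 2) * (qv ^ (k - l) * q_binom k l)"
    proof (cases "l \<le> k")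
      case True
      then have "k + l * (l - 1) div 2 = Suc l * (Suc l - 1) div 2 + (k - l)"
        by (subst triangular_exponent) simp
      then show ?thesis by (metis mult.assoc power_add)
    qed (simp add: q_binom_def)
    then show ?thesis unfolding nth Suc.IH Suc q_binom_Suc_Suc
      by (simp add: distrib_left)
  qed
qed

lemma eq_mult_inverse_fps:
  fixes F :: "'b::field fps"
  assumes "F * (1 - fps_const c * fps_X) = G"
  shows "F = G * inverse (1 - fps_const c * fps_X)"
proof -
  have "inverse (1 - fps_const c * fps_X) * (1 - fps_const c * fps_X) = 1"
    by (rule inverse_mult_eq_1) simp
  then show ?thesis unfolding assms[symmetric] by (simp add: mult.assoc mult.commute[of "inverse _"])
qed

text \<open>In the q-Pascal rule for \<open>k + m\<close> and \<open>m - 1\<close> the exponent is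
  \<open>Suc k\<close> for every positive \<open>m\<close>, so multiplying the series by
  \<open>1 - q^(k+1) z\<close> lowers \<open>k + 1\<close> to \<open>k\<close>.\<close>

lemma q_negative_binomial_theorem:
  "(\<Prod>a\<le>k. inverse (1 - fps_const (qv ^ a) * fps_X)) = Abs_fps (\<lambda>m. q_binom (k + m) m)"
proof (induction k)
  case 0
  have "Abs_fps (\<lambda>m. q_binom (0 + m) m) * (1 - fps_const 1 * fps_X) = 1"
  proof (rule fps_ext)
    fix m
    show "(Abs_fps (\<lambda>m. q_binom (0 + m) m) * (1 - fps_const 1 * fps_X)) $ m = 1 $ m"
      by (subst fps_mult_one_minus_nth) (simp add: q_binom_self)
  qed
  from eq_mult_inverse_fps[OF this] show ?case by simp
next
  case (Suc k)
  have "Abs_fps (\<lambda>m. q_binom (Suc k + m) m) * (1 - fps_const (qv ^ Suc k) * fps_X) =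
     Abs_fps (\<lambda>m. q_binom (k + m) m)"
  proof (rule fps_ext)
    fix m
    show "(Abs_fps (\<lambda>m. q_binom (Suc k + m) m) * (1 - fps_const (qv ^ Suc k) * fps_X)) $ m =
        Abs_fps (\<lambda>m. q_binom (k + m) m) $ m"
      using q_binom_Suc_Suc[of "k + m" "m - 1"]
      by (cases m) (simp_all only: fps_mult_one_minus_nth, simp_all add: q_binom_0)
  qed
  from eq_mult_inverse_fps[OF this] show ?case by (simp only: prod.atMost_Suc Suc.IH)
qed

section \<open>The generating function common to a letter and a cross polytope\<close>

text \<open>At q = 1 this is \<open>(1+z)^k / (1-z)^(k+1)\<close>, the generating function of the
  Delannoy numbers, which count the lattice points of the \<open>k\<close>-th dilates of cross
  polytopes, with \<open>z\<close> marking the dimension.\<close>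

definition cross_fps :: "nat \<Rightarrow> rat poly fract fps" where
  "cross_fps k = (\<Prod>a<k. 1 + fps_const (qv ^ a) * fps_X) *
                 (\<Prod>a\<le>k. inverse (1 - fps_const (qv ^ a) * fps_X))"

text \<open>For \<open>j \<le> k\<close> both sides are
  \<open>[k+m-j]! / ([j]! [m-j]! [k-j]!)\<close>; for \<open>k < j\<close> both vanish.\<close>

lemma q_binom_swap:
  assumes "j \<le> m"
  shows "q_binom k j * q_binom (k + (m - j)) (m - j) = q_binom m j * q_binom (k + m - j) m"
proof (cases "j \<le> k")
  case True
  have "k + (m - j) = k + m - j" "k + m - j - (m - j) = k" "k + m - j - m = k - j"
    "m - j \<le> k + m - j" "m \<le> k + m - j"
    using True assms by auto
  then show ?thesis
    using True assms q_fact_nonzero by (simp add: q_binom_def field_simps)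
qed (use assms in \<open>simp add: q_binom_def\<close>)

lemma cross_fps_nth:
  "cross_fps k $ m = (\<Sum>j = 0..m. qv ^ (j * (j - 1) div 2) * q_binom m j * q_binom (k + m - j) m)"
  unfolding cross_fps_def fps_mult_nth q_binomial_theorem q_negative_binomial_theorem
proof (rule sum.cong)
  fix j assume "j \<in> {0..m}"
  then have "q_binom k j * q_binom (k + (m - j)) (m - j) = q_binom m j * q_binom (k + m - j) m"
    by (intro q_binom_swap) simp
  then show "qv ^ (j * (j - 1) div 2) * q_binom k j * Abs_fps (\<lambda>m. q_binom (k + m) m) $ (m - j) =
      qv ^ (j * (j - 1) div 2) * q_binom m j * q_binom (k + m - j) m"
    by (simp only: fps_nth_Abs_fps mult.assoc)
qed simp

lemma cross_fps_nth_0: "cross_fps k $ 0 = 1"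
  by (simp add: cross_fps_nth q_binom_0)

text \<open>Passing from \<open>k\<close> to \<open>k + 1\<close> multiplies the series by
  \<open>(1 + q^k z) / (1 - q^(k+1) z)\<close>; the denominator is cleared and coefficients are
  compared.\<close>

lemma cross_fps_Suc_nth_Suc:
  "cross_fps (Suc k) $ Suc m =
     qv ^ Suc k * cross_fps (Suc k) $ m + cross_fps k $ Suc m + qv ^ k * cross_fps k $ m"
proof -
  have inv: "inverse (1 - fps_const (qv ^ Suc k) * fps_X) * (1 - fps_const (qv ^ Suc k) * fps_X) = 1"
    by (rule inverse_mult_eq_1) simp
  have "cross_fps (Suc k) * (1 - fps_const (qv ^ Suc k) * fps_X) =
      cross_fps k * (1 + fps_const (qv ^ k) * fps_X) *
      (inverse (1 - fps_const (qv ^ Suc k) * fps_X) * (1 - fps_const (qv ^ Suc k) * fps_X))"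
    unfolding cross_fps_def prod.lessThan_Suc prod.atMost_Suc by (simp only: mult_ac)
  also have "\<dots> = cross_fps k * (1 + fps_const (qv ^ k) * fps_X)" by (simp only: inv mult_1_right)
  \<comment> \<open>The sign is moved into the constant so that
    \<open>fps_mult_one_minus_nth\<close> applies to both sides.\<close>
  also have "\<dots> = cross_fps k * (1 - fps_const (- (qv ^ k)) * fps_X)" by (simp flip: fps_const_neg)
  finally have "(cross_fps (Suc k) * (1 - fps_const (qv ^ Suc k) * fps_X)) $ Suc m =
      (cross_fps k * (1 - fps_const (- (qv ^ k)) * fps_X)) $ Suc m" by simp
  then show ?thesis unfolding fps_mult_one_minus_nth by (simp add: algebra_simps)
qed

text \<open>The previous recursion summed over \<open>k\<close>. In this form it mirrors slicing by
  the last coordinate \<open>v\<close>, with \<open>c = k - |v|\<close>: one slice for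
  \<open>c = k\<close> and two for each smaller \<open>c\<close>.\<close>

lemma cross_fps_rec:
  "cross_fps k $ Suc m = qv ^ k * cross_fps k $ m + 2 * (\<Sum>c<k. qv ^ c * cross_fps c $ m)"
proof (induction k)
  case 0
  have "cross_fps 0 = Abs_fps (\<lambda>m. 1)"
    unfolding cross_fps_def q_negative_binomial_theorem by (simp add: q_binom_self)
  then show ?case by simp
next
  case (Suc k)
  then show ?case by (simp add: cross_fps_Suc_nth_Suc algebra_simps)
qed

section \<open>Lattice points of cross polytopes\<close>

definition int_cross :: "nat \<Rightarrow> nat \<Rightarrow> int list set" where
  "int_cross m k = {x. length x = m \<and> (\<Sum>i<m. \<bar>x ! i\<bar>) \<le> int k}"

lemma int_cross_Suc:
  "int_cross (Suc m) k = (\<Union>v\<in>{- int k..int k}. (\<lambda>x. x @ [v]) ` int_cross m (k - nat \<bar>v\<bar>))"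
proof -
  have "x @ [v] \<in> int_cross (Suc m) k \<longleftrightarrow>
      v \<in> {- int k..int k} \<and> x \<in> int_cross m (k - nat \<bar>v\<bar>)" for x v
  proof (cases "length x = m")
    case True
    define s where "s = (\<Sum>i<m. \<bar>x ! i\<bar>)"
    have "0 \<le> s" unfolding s_def by (rule sum_nonneg) simp
    moreover have "(\<Sum>i<Suc m. \<bar>(x @ [v]) ! i\<bar>) = s + \<bar>v\<bar>"
      using True by (simp add: nth_append s_def)
    then have "x @ [v] \<in> int_cross (Suc m) k \<longleftrightarrow> s + \<bar>v\<bar> \<le> int k"
      using True by (simp add: int_cross_def)
    moreover have "x \<in> int_cross m (k - nat \<bar>v\<bar>) \<longleftrightarrow> s \<le> int (k - nat \<bar>v\<bar>)"
      using True by (simp add: int_cross_def s_def)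
    ultimately show ?thesis by auto
  qed (simp add: int_cross_def)
  note * = this
  show ?thesis
  proof (rule set_eqI)
    fix x
    show "x \<in> int_cross (Suc m) k \<longleftrightarrow>
        x \<in> (\<Union>v\<in>{- int k..int k}. (\<lambda>x. x @ [v]) ` int_cross m (k - nat \<bar>v\<bar>))"
    proof (cases x rule: rev_cases)
      case Nil
      then show ?thesis by (auto simp: int_cross_def)
    next
      case (snoc y v)
      show ?thesis unfolding snoc * by auto
    qed
  qed
qed

lemma finite_int_cross: "finite (int_cross m k)"
proof (induction m arbitrary: k)
  case 0
  have "int_cross 0 k = {[]}" by (auto simp: int_cross_def)
  then show ?case by simp
qed (simp add: int_cross_Suc)

text \<open>Every tail sum in \<open>mu\<close> contains the last coordinate, so fixing it lowers
  \<open>k\<close> by its absolute value in all terms; the new last term contributes the lowered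
  \<open>k\<close> itself.\<close>

lemma mu_append:
  assumes "length y = m" and "\<bar>v\<bar> \<le> int k"
  shows "mu k (Suc m) (map abs (y @ [v])) =
           int (k - nat \<bar>v\<bar>) + mu (k - nat \<bar>v\<bar>) m (map abs y)"
proof -
  have tail: "(\<Sum>l = i..<Suc m. map abs (y @ [v]) ! l) = (\<Sum>l = i..<m. map abs y ! l) + \<bar>v\<bar>"
    if "i \<le> m" for i
  proof -
    have "(\<Sum>l = i..<m. map abs (y @ [v]) ! l) = (\<Sum>l = i..<m. map abs y ! l)"
      by (rule sum.cong) (use assms in \<open>auto simp: nth_append\<close>)
    moreover have "map abs (y @ [v]) ! m = \<bar>v\<bar>" using assms by (simp add: nth_append)
    ultimately show ?thesis using that by (simp only: sum.op_ivl_Suc) simp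
  qed
  have "(\<Sum>i<m. int k - (\<Sum>l = i..<Suc m. map abs (y @ [v]) ! l)) =
      (\<Sum>i<m. int (k - nat \<bar>v\<bar>) - (\<Sum>l = i..<m. map abs y ! l))"
  proof (rule sum.cong)
    fix i assume "i \<in> {..<m}"
    then show "int k - (\<Sum>l = i..<Suc m. map abs (y @ [v]) ! l) =
        int (k - nat \<bar>v\<bar>) - (\<Sum>l = i..<m. map abs y ! l)"
      using tail[of i] assms by simp
  qed simp
  moreover have "int k - (\<Sum>l = m..<Suc m. map abs (y @ [v]) ! l) = int (k - nat \<bar>v\<bar>)"
    using tail[of m] assms by simp
  ultimately show ?thesis unfolding mu_def sum.lessThan_Suc by simp
qed

text \<open>The value \<open>k\<close> of the argument comes from \<open>v = 0\<close> alone, each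
  \<open>c < k\<close> from \<open>v = k - c\<close> and \<open>v = c - k\<close>.\<close>

lemma sum_symmetric_interval:
  fixes f :: "nat \<Rightarrow> 'b::comm_ring_1"
  shows "(\<Sum>v\<in>{- int k..int k}. f (k - nat \<bar>v\<bar>)) = f k + 2 * (\<Sum>c<k. f c)"
proof -
  have "{- int k..int k} = insert 0 ({1..int k} \<union> {- int k..-1})" by auto
  then have "(\<Sum>v\<in>{- int k..int k}. f (k - nat \<bar>v\<bar>)) =
     f k + ((\<Sum>v\<in>{1..int k}. f (k - nat \<bar>v\<bar>)) + (\<Sum>v\<in>{- int k..-1}. f (k - nat \<bar>v\<bar>)))"
    by (simp add: sum.union_disjoint)
  also have "(\<Sum>v\<in>{1..int k}. f (k - nat \<bar>v\<bar>)) = (\<Sum>c<k. f c)"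
    by (rule sum.reindex_bij_witness[of _ "\<lambda>c. int (k - c)" "\<lambda>v. k - nat v"]) auto
  also have "(\<Sum>v\<in>{- int k..-1}. f (k - nat \<bar>v\<bar>)) = (\<Sum>c<k. f c)"
    by (rule sum.reindex_bij_witness[of _ "\<lambda>c. - int (k - c)" "\<lambda>v. k - nat (- v)"]) auto
  finally show ?thesis by simp
qed

text \<open>Slicing by the last coordinate, with \<open>mu_append\<close> for the weights,
  reproduces the recursion \<open>cross_fps_rec\<close>.\<close>

lemma sum_int_cross:
  "(\<Sum>x\<in>int_cross m k. qv powi mu k m (map abs x)) = cross_fps k $ m"
proof (induction m arbitrary: k)
  case 0
  have "int_cross 0 k = {[]}" by (auto simp: int_cross_def)
  then show ?case by (simp add: mu_def cross_fps_nth_0)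
next
  case (Suc m)
  have "(\<Sum>x\<in>int_cross (Suc m) k. qv powi mu k (Suc m) (map abs x)) =
     (\<Sum>v\<in>{- int k..int k}. \<Sum>x\<in>(\<lambda>x. x @ [v]) ` int_cross m (k - nat \<bar>v\<bar>).
        qv powi mu k (Suc m) (map abs x))"
    unfolding int_cross_Suc by (rule sum.UNION_disjoint) (auto simp: finite_int_cross)
  also have "\<dots> = (\<Sum>v\<in>{- int k..int k}. qv ^ (k - nat \<bar>v\<bar>) * cross_fps (k - nat \<bar>v\<bar>) $ m)"
  proof (rule sum.cong)
    fix v assume v: "v \<in> {- int k..int k}"
    have "(\<Sum>x\<in>(\<lambda>x. x @ [v]) ` int_cross m (k - nat \<bar>v\<bar>). qv powi mu k (Suc m) (map abs x)) =
       (\<Sum>x\<in>int_cross m (k - nat \<bar>v\<bar>). qv powi mu k (Suc m) (map abs (x @ [v])))"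
      by (subst sum.reindex) (auto simp: inj_on_def)
    also have "\<dots> = (\<Sum>x\<in>int_cross m (k - nat \<bar>v\<bar>).
        qv ^ (k - nat \<bar>v\<bar>) * qv powi mu (k - nat \<bar>v\<bar>) m (map abs x))"
    proof (rule sum.cong)
      fix x assume "x \<in> int_cross m (k - nat \<bar>v\<bar>)"
      then have "length x = m" by (simp add: int_cross_def)
      moreover have "\<bar>v\<bar> \<le> int k" using v by auto
      ultimately show "qv powi mu k (Suc m) (map abs (x @ [v])) =
          qv ^ (k - nat \<bar>v\<bar>) * qv powi mu (k - nat \<bar>v\<bar>) m (map abs x)"
        using qv_nonzero by (simp only: mu_append power_int_add simp_thms power_int_of_nat)
    qed simp
    finally show "(\<Sum>x\<in>(\<lambda>x. x @ [v]) ` int_cross m (k - nat \<bar>v\<bar>).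
          qv powi mu k (Suc m) (map abs x)) = qv ^ (k - nat \<bar>v\<bar>) * cross_fps (k - nat \<bar>v\<bar>) $ m"
      by (simp add: sum_distrib_left[symmetric] Suc.IH)
  qed simp
  also have "\<dots> = cross_fps k $ Suc m"
    using sum_symmetric_interval[of "\<lambda>c. qv ^ c * cross_fps c $ m" k] by (simp add: cross_fps_rec)
  finally show ?case .
qed

lemma lattice_points_dilate:
  "lattice_points (dilate k (cross_polytope_prod \<eta>)) =
     {x. length x = length \<eta> \<and> (\<forall>i<length \<eta>. x ! i \<in> int_cross (\<eta> ! i) k)}" (is "?L = ?R")
proof (intro equalityI subsetI)
  fix x assume "x \<in> ?L"
  then obtain y where y: "y \<in> cross_polytope_prod \<eta>"
    and xy: "map (map real_of_int) x = map (map (\<lambda>c. real k * c)) y"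
    by (auto simp: lattice_points_def dilate_def)
  have len: "length x = length y" using arg_cong[OF xy, of length] by simp
  have "x ! i \<in> int_cross (\<eta> ! i) k" if i: "i < length \<eta>" for i
  proof -
    have yi: "length (y ! i) = \<eta> ! i" "(\<Sum>l<\<eta> ! i. \<bar>y ! i ! l\<bar>) \<le> 1"
      using y i by (auto simp: cross_polytope_prod_def cross_polytope_def)
    have iy: "i < length y" using y i by (auto simp: cross_polytope_prod_def)
    have eq: "map real_of_int (x ! i) = map (\<lambda>c. real k * c) (y ! i)"
      using arg_cong[OF xy, of "\<lambda>z. z ! i"] iy len by simp
    have leni: "length (x ! i) = \<eta> ! i" using arg_cong[OF eq, of length] yi by simp
    have "real_of_int (\<Sum>l<\<eta> ! i. \<bar>x ! i ! l\<bar>) = (\<Sum>l<\<eta> ! i. real k * \<bar>y ! i ! l\<bar>)"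
      unfolding of_int_sum
    proof (rule sum.cong)
      fix l assume l: "l \<in> {..<\<eta> ! i}"
      have "real_of_int (x ! i ! l) = real k * y ! i ! l"
        using arg_cong[OF eq, of "\<lambda>z. z ! l"] l yi leni by simp
      then show "real_of_int \<bar>x ! i ! l\<bar> = real k * \<bar>y ! i ! l\<bar>" by (simp add: abs_mult)
    qed simp
    also have "\<dots> \<le> real k"
      using mult_left_mono[OF yi(2), of "real k"] by (simp add: sum_distrib_left)
    finally have "(\<Sum>l<\<eta> ! i. \<bar>x ! i ! l\<bar>) \<le> int k" by linarith
    then show ?thesis using leni by (simp add: int_cross_def)
  qed
  then show "x \<in> ?R" using len y by (simp add: cross_polytope_prod_def)
next
  fix x assume x: "x \<in> ?R"
  \<comment> \<open>For \<open>k = 0\<close> the quotient is \<open>0\<close>, which is right since then all entries of \<open>x\<close> vanish.\<close>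
  define y where "y = map (map (\<lambda>c. real_of_int c / real k)) x"
  have xi: "length (x ! i) = \<eta> ! i" "(\<Sum>l<\<eta> ! i. \<bar>x ! i ! l\<bar>) \<le> int k" if "i < length \<eta>" for i
    using x that by (auto simp: int_cross_def)
  have "y \<in> cross_polytope_prod \<eta>"
  proof -
    have "(\<Sum>l<\<eta> ! i. \<bar>y ! i ! l\<bar>) \<le> 1" if i: "i < length \<eta>" for i
    proof -
      have "(\<Sum>l<\<eta> ! i. \<bar>y ! i ! l\<bar>) = real_of_int (\<Sum>l<\<eta> ! i. \<bar>x ! i ! l\<bar>) / real k"
        unfolding of_int_sum sum_divide_distrib
        by (rule sum.cong) (use i x xi in \<open>auto simp: y_def\<close>)
      also have "\<dots> \<le> real k / real k"
      proof (rule divide_right_mono)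
        have "real_of_int (\<Sum>l<\<eta> ! i. \<bar>x ! i ! l\<bar>) \<le> real_of_int (int k)"
          using xi(2)[OF i] by (simp only: of_int_le_iff)
        then show "real_of_int (\<Sum>l<\<eta> ! i. \<bar>x ! i ! l\<bar>) \<le> real k" by simp
      qed simp
      \<comment> \<open>The quotient is 1, or 0 when \<open>k = 0\<close>.\<close>
      also have "\<dots> \<le> 1" by simp
      finally show ?thesis .
    qed
    then show ?thesis using x xi by (auto simp: cross_polytope_prod_def cross_polytope_def y_def)
  qed
  moreover have "map (map real_of_int) x = map (map (\<lambda>c. real k * c)) y"
  proof -
    have "real_of_int c = real k * (real_of_int c / real k)" if "z \<in> set x" "c \<in> set z" for z c
    proof (cases "k = 0")
      case True
      obtain i l where i: "i < length \<eta>" "z = x ! i" and l: "l < length z" "c = z ! l"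
        using \<open>z \<in> set x\<close> \<open>c \<in> set z\<close> x by (auto simp: in_set_conv_nth)
      have "(\<Sum>l<\<eta> ! i. \<bar>x ! i ! l\<bar>) = 0"
        using xi(2)[OF i(1)] True by (intro antisym sum_nonneg) auto
      then have "\<bar>x ! i ! l\<bar> = 0" using l i xi(1)[OF i(1)]
        by (subst (asm) sum_nonneg_eq_0_iff) auto
      then show ?thesis using i l by simp
    qed simp
    then show ?thesis by (auto simp: y_def)
  qed
  ultimately show "x \<in> ?L" by (auto simp: lattice_points_def dilate_def)
qed

text \<open>The exponent \<open>mu_bar\<close> adds over the blocks and the blocks vary
  independently, so the sum factors.\<close>

lemma sum_lattice_points:
  "(\<Sum>x | length x = length \<eta> \<and> (\<forall>i<length \<eta>. x ! i \<in> int_cross (\<eta> ! i) k).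
      qv powi mu_bar k \<eta> x) = (\<Prod>i<length \<eta>. cross_fps k $ (\<eta> ! i))"
proof (induction \<eta>)
  case Nil
  then show ?case by (simp add: mu_bar_def)
next
  case (Cons m \<eta>)
  let ?S = "\<lambda>\<eta>. {x. length x = length \<eta> \<and> (\<forall>i<length \<eta>. x ! i \<in> int_cross (\<eta> ! i) k)}"
  have "?S (m # \<eta>) = (\<lambda>(y, x). y # x) ` (int_cross m k \<times> ?S \<eta>)"
  proof -
    have "y # x \<in> ?S (m # \<eta>) \<longleftrightarrow> y \<in> int_cross m k \<and> x \<in> ?S \<eta>" for x y
      by (auto simp: All_less_Suc2)
    note * = this
    show ?thesis
    proof (rule set_eqI)
      fix x
      show "x \<in> ?S (m # \<eta>) \<longleftrightarrow> x \<in> (\<lambda>(y, x). y # x) ` (int_cross m k \<times> ?S \<eta>)"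
      proof (cases x)
        case Nil
        then show ?thesis by auto
      next
        case (Cons y z)
        show ?thesis unfolding Cons * by (auto simp del: mem_Collect_eq)
      qed
    qed
  qed
  then have "(\<Sum>x\<in>?S (m # \<eta>). qv powi mu_bar k (m # \<eta>) x) =
     (\<Sum>(y, x)\<in>int_cross m k \<times> ?S \<eta>. qv powi mu_bar k (m # \<eta>) (y # x))"
    by (simp only:) (subst sum.reindex, auto simp: inj_on_def case_prod_unfold)
  also have "\<dots> = (\<Sum>(y, x)\<in>int_cross m k \<times> ?S \<eta>.
      qv powi mu k m (map abs y) * qv powi mu_bar k \<eta> x)"
    using qv_nonzero
    by (simp add: mu_bar_def sum.lessThan_Suc_shift power_int_add del: sum.lessThan_Suc)
  also have "\<dots> = (\<Sum>y\<in>int_cross m k. qv powi mu k m (map abs y)) *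
      (\<Sum>x\<in>?S \<eta>. qv powi mu_bar k \<eta> x)"
    by (simp add: sum_product sum.cartesian_product)
  finally show ?case using Cons
    by (simp add: sum_int_cross prod.lessThan_Suc_shift del: prod.lessThan_Suc)
qed

lemma Ehr_eq: "Ehr \<eta> = Abs_fps (\<lambda>k. \<Prod>i<length \<eta>. cross_fps k $ (\<eta> ! i))"
  unfolding Ehr_def lattice_points_dilate sum_lattice_points ..

section \<open>Signed multiset permutations\<close>

text \<open>Extended by 0 to all naturals, as required of the colour counts of
  \<open>sorted_words\<close>.\<close>

definition letter_count :: "nat list \<Rightarrow> nat \<Rightarrow> nat" where
  "letter_count \<eta> j = (if 1 \<le> j \<and> j \<le> length \<eta> then \<eta> ! (j - 1) else 0)"

lemma S_eta_iff: "w \<in> S_eta \<eta> \<longleftrightarrow> (\<forall>j. count_list w j = letter_count \<eta> j)"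
proof -
  have "count (\<Sum>i = 1..length \<eta>. replicate_mset (\<eta> ! (i - 1)) i) j = letter_count \<eta> j" for j
  proof -
    have "count (\<Sum>i = 1..length \<eta>. replicate_mset (\<eta> ! (i - 1)) i) j =
        (\<Sum>i = 1..length \<eta>. if i = j then \<eta> ! (i - 1) else 0)"
      by (simp add: count_sum)
    then show ?thesis by (simp add: letter_count_def)
  qed
  then show ?thesis
    by (simp add: S_eta_def permutations_of_multiset_def multiset_eq_iff count_mset)
qed

lemma S_eta_letter:
  assumes "w \<in> S_eta \<eta>" and "a \<in> set w"
  shows "1 \<le> a" and "a \<le> length \<eta>"
proof -
  have "letter_count \<eta> a \<noteq> 0"
    using assms unfolding S_eta_iff by (metis count_list_0_iff)
  then show "1 \<le> a" "a \<le> length \<eta>" by (auto simp: letter_count_def split: if_splits)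
qed

lemma length_S_eta:
  assumes "w \<in> S_eta \<eta>"
  shows "length w = sum_list \<eta>"
proof -
  have "length w = size (\<Sum>i = 1..length \<eta>. replicate_mset (\<eta> ! (i - 1)) i)"
    using assms by (simp add: S_eta_def length_finite_permutations_of_multiset)
  also have "\<dots> = (\<Sum>i = 1..length \<eta>. \<eta> ! (i - 1))" by simp
  also have "\<dots> = (\<Sum>i<length \<eta>. \<eta> ! i)" by (simp add: sum.atLeast1_atMost_eq)
  finally show ?thesis by (simp add: sum_list_sum_nth atLeast0LessThan)
qed

lemma finite_B_eta: "finite (B_eta \<eta>)"
proof (rule finite_subset)
  show "B_eta \<eta> \<subseteq> S_eta \<eta> \<times> {\<epsilon>. set \<epsilon> \<subseteq> {1, -1} \<and> length \<epsilon> = sum_list \<eta>}"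
    by (auto simp: B_eta_def length_S_eta)
  show "finite (S_eta \<eta> \<times> {\<epsilon> :: int list. set \<epsilon> \<subseteq> {1, -1} \<and> length \<epsilon> = sum_list \<eta>})"
    by (intro finite_cartesian_product finite_lists_length_eq) (auto simp: S_eta_def)
qed

lemma length_std: "length (std \<eta> w) = length w"
  by (simp add: std_def)

lemma sum_list_take_mono: "i \<le> j \<Longrightarrow> sum_list (take i \<eta>) \<le> sum_list (take j (\<eta> :: nat list))"
  by (metis le_add1 min.absorb1 append_take_drop_id sum_list_append take_take)

text \<open>Each letter is standardised into its own block of integers, since its running count lies
  between 1 and its multiplicity.\<close>

lemma std_bounds:
  assumes "w \<in> S_eta \<eta>" and "i < length w"
  shows "sum_list (take (w ! i - 1) \<eta>) < std \<eta> w ! i"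
    and "std \<eta> w ! i \<le> sum_list (take (w ! i) \<eta>)"
proof -
  let ?c = "count_list (take (Suc i) w) (w ! i)"
  have std: "std \<eta> w ! i = sum_list (take (w ! i - 1) \<eta>) + ?c"
    using assms(2) by (simp add: std_def)
  have "w ! i \<in> set (take (Suc i) w)" using assms(2) by (simp add: take_Suc_conv_app_nth)
  then have "?c \<noteq> 0" by (simp add: count_list_0_iff)
  then show "sum_list (take (w ! i - 1) \<eta>) < std \<eta> w ! i" by (simp add: std)
  have l: "1 \<le> w ! i" "w ! i \<le> length \<eta>" using S_eta_letter[OF assms(1)] assms(2) by auto
  have "?c \<le> count_list w (w ! i)"
    by (metis append_take_drop_id count_list_append le_add1)
  also have "\<dots> = \<eta> ! (w ! i - 1)"
    using assms(1) l by (simp add: S_eta_iff letter_count_def)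
  finally have "std \<eta> w ! i \<le> sum_list (take (w ! i - 1) \<eta>) + \<eta> ! (w ! i - 1)" by (simp add: std)
  also have "\<dots> = sum_list (take (Suc (w ! i - 1)) \<eta>)"
    using l by (subst take_Suc_conv_app_nth) auto
  finally show "std \<eta> w ! i \<le> sum_list (take (w ! i) \<eta>)" using l by simp
qed

text \<open>Different letters fall into disjoint blocks ordered like the letters; equal neighbours
  receive consecutive numbers, so a tie becomes an ascent.\<close>

lemma std_Suc_less_iff:
  assumes w: "w \<in> S_eta \<eta>" and i: "Suc i < length w"
  shows "std \<eta> w ! i < std \<eta> w ! Suc i \<longleftrightarrow> w ! i \<le> w ! Suc i"
    and "std \<eta> w ! Suc i < std \<eta> w ! i \<longleftrightarrow> w ! Suc i < w ! i"
proof -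
  have b: "sum_list (take (w ! i - 1) \<eta>) < std \<eta> w ! i" "std \<eta> w ! i \<le> sum_list (take (w ! i) \<eta>)"
    "sum_list (take (w ! Suc i - 1) \<eta>) < std \<eta> w ! Suc i"
    "std \<eta> w ! Suc i \<le> sum_list (take (w ! Suc i) \<eta>)"
    using std_bounds[OF w, of i] std_bounds[OF w, of "Suc i"] i by auto
  consider "w ! i < w ! Suc i" | "w ! i = w ! Suc i" | "w ! Suc i < w ! i" by linarith
  then have "(std \<eta> w ! i < std \<eta> w ! Suc i \<longleftrightarrow> w ! i \<le> w ! Suc i) \<and>
      (std \<eta> w ! Suc i < std \<eta> w ! i \<longleftrightarrow> w ! Suc i < w ! i)"
  proof cases
    case 1
    then have "sum_list (take (w ! i) \<eta>) \<le> sum_list (take (w ! Suc i - 1) \<eta>)"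
      by (intro sum_list_take_mono) simp
    with b 1 show ?thesis by linarith
  next
    case 2
    have "take (Suc (Suc i)) w = take (Suc i) w @ [w ! Suc i]"
      using i by (rule take_Suc_conv_app_nth)
    then have "std \<eta> w ! Suc i = Suc (std \<eta> w ! i)" using i 2 by (simp add: std_def)
    with 2 show ?thesis by simp
  next
    case 3
    then have "sum_list (take (w ! Suc i) \<eta>) \<le> sum_list (take (w ! i - 1) \<eta>)"
      by (intro sum_list_take_mono) simp
    with b 3 show ?thesis by linarith
  qed
  then show "std \<eta> w ! i < std \<eta> w ! Suc i \<longleftrightarrow> w ! i \<le> w ! Suc i"
    and "std \<eta> w ! Suc i < std \<eta> w ! i \<longleftrightarrow> w ! Suc i < w ! i" by auto
qed

section \<open>Descents read off the signed letters\<close>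

definition signed_word :: "nat list \<times> int list \<Rightarrow> int list" where
  "signed_word = (\<lambda>(w, \<epsilon>). map2 (\<lambda>s v. s * int v) \<epsilon> w)"

text \<open>Equal negative neighbours count as a descent because their standardised absolute values
  increase. At position 0 the leading 0 makes a descent mean a negative first letter.\<close>

definition word_descents :: "int list \<Rightarrow> nat set" where
  "word_descents t = {i. i < length t \<and>
     ((0 # t) ! Suc i < (0 # t) ! i \<or> (0 # t) ! Suc i = (0 # t) ! i \<and> (0 # t) ! i < 0)}"

lemma length_signed_word: "x \<in> B_eta \<eta> \<Longrightarrow> length (signed_word x) = sum_list \<eta>"
  by (auto simp: signed_word_def B_eta_def length_S_eta)

text \<open>Standardisation keeps signs, and within one sign \<open>std_Suc_less_iff\<close> settles
  the comparison, ties included.\<close>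

lemma Des_eq_word_descents:
  assumes "x \<in> B_eta \<eta>"
  shows "Des \<eta> x = word_descents (signed_word x)"
proof -
  obtain w \<epsilon> where x: "x = (w, \<epsilon>)" by fastforce
  have w: "w \<in> S_eta \<eta>" and len: "length \<epsilon> = length w" and sg: "set \<epsilon> \<subseteq> {1, -1}"
    using assms by (auto simp: x B_eta_def)
  have sgn: "\<epsilon> ! i = 1 \<or> \<epsilon> ! i = -1" if "i < length w" for i
    using subsetD[OF sg nth_mem[of i \<epsilon>]] len that by auto
  have pos: "0 < w ! i" "0 < std \<eta> w ! i" if "i < length w" for i
    using S_eta_letter(1)[OF w, of "w ! i"] std_bounds(1)[OF w that] that by auto
  have ss: "signed_std \<eta> x ! Suc i = \<epsilon> ! i * int (std \<eta> w ! i)" if "i < length w" for i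
    using that len by (simp add: x signed_std_def length_std)
  have sw: "(0 # signed_word x) ! Suc i = \<epsilon> ! i * int (w ! i)" if "i < length w" for i
    using that len by (simp add: x signed_word_def)
  have "signed_std \<eta> x ! Suc i < signed_std \<eta> x ! i \<longleftrightarrow>
     (0 # signed_word x) ! Suc i < (0 # signed_word x) ! i \<or>
     (0 # signed_word x) ! Suc i = (0 # signed_word x) ! i \<and> (0 # signed_word x) ! i < 0"
    if i: "i < length w" for i
  proof (cases i)
    case 0
    have "signed_std \<eta> x ! 0 = 0" by (simp add: x signed_std_def)
    moreover have "(0 # signed_word x) ! 0 = 0" by simp
    ultimately show ?thesis using sgn[OF i] pos[OF i] ss[OF i] sw[OF i] unfolding 0 by auto
  next
    case (Suc p)
    have p: "Suc p < length w" "p < length w" using i Suc by auto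
    show ?thesis
      unfolding Suc ss[OF p(1)] ss[OF p(2)] sw[OF p(1)] sw[OF p(2)]
      using sgn[OF p(1)] sgn[OF p(2)] pos[OF p(1)] pos[OF p(2)] std_Suc_less_iff[OF w p(1)]
      by auto
  qed
  moreover have "length (signed_word x) = length w" "length (fst x) = length w"
    using len by (simp_all add: x signed_word_def)
  ultimately show ?thesis
    by (auto simp: Des_def word_descents_def)
qed

section \<open>Signed words with chains as sorted lists of pairs\<close>

text \<open>The order on pairs is lexicographic, so the last condition bounds the chain entry by
  \<open>k\<close> for a positive letter and by \<open>k - 1\<close> for a negative one.\<close>

definition alphabet :: "nat \<Rightarrow> nat \<Rightarrow> (int \<times> int) set" where
  "alphabet r k = {x. fst x \<le> 0 \<and> 1 \<le> \<bar>snd x\<bar> \<and> \<bar>snd x\<bar> \<le> int r \<and> (- int k, 0) < x}"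

text \<open>Negating the entries turns a weakly decreasing chain into an increasing first
  component.\<close>

definition encode :: "int list \<Rightarrow> nat list \<Rightarrow> (int \<times> int) list" where
  "encode t a = zip (map (\<lambda>c. - int c) a) t"

text \<open>A chain with strict steps at the descents is the same as a sorted sequence of pairs; the
  leading pair \<open>(-k, 0)\<close> encodes both the upper bound \<open>k\<close> and a possible descent at \<open>0\<close>.\<close>

lemma chains_iff_sorted:
  assumes len: "length a = length t" and t: "\<And>s. s \<in> set t \<Longrightarrow> 1 \<le> \<bar>s\<bar> \<and> \<bar>s\<bar> \<le> int r"
  shows "a \<in> chains (length t) (word_descents t) k \<longleftrightarrow>
    set (encode t a) \<subseteq> alphabet r k \<and>
    sorted_wrt (\<lambda>x y. x < y \<or> x = y \<and> 0 < snd x) (encode t a)"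
proof -
  let ?R = "\<lambda>x y :: int \<times> int. x < y \<or> x = y \<and> 0 < snd x"
  let ?z = "(- int k, 0) # encode t a"
  have tr: "transp ?R" by (auto simp: transp_def)
  have z: "?z ! i = (- int ((k # a) ! i), (0 # t) ! i)" if "i < Suc (length t)" for i
    using that len by (cases i) (simp_all add: encode_def)
  have "a \<in> chains (length t) (word_descents t) k \<longleftrightarrow> (\<forall>i<length t. ?R (?z ! i) (?z ! Suc i))"
  proof -
    \<comment> \<open>When \<open>b = c\<close> both sides say \<open>s < s'\<close> or
      \<open>s = s' > 0\<close>; the assumption on \<open>s'\<close> excludes two zeros, where they
      would differ.\<close>
    have pair: "b \<le> c \<and> (s' < s \<or> s' = s \<and> s < 0 \<longrightarrow> b < c) \<longleftrightarrow>
        ?R (- int c, s) (- int b, s')" if "s' \<noteq> 0" for b c :: nat and s s' :: int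
      using that by auto
    have "((k # a) ! Suc i \<le> (k # a) ! i \<and>
        (i \<in> word_descents t \<longrightarrow> (k # a) ! Suc i < (k # a) ! i)) \<longleftrightarrow> ?R (?z ! i) (?z ! Suc i)"
      if i: "i < length t" for i
    proof -
      have nz: "(0 # t) ! Suc i \<noteq> 0" using t[of "t ! i"] i by auto
      have i': "i < Suc (length t)" "Suc i < Suc (length t)" using i by auto
      show ?thesis
        unfolding z[OF i'(1)] z[OF i'(2)] pair[OF nz, symmetric] word_descents_def
        using i by (simp only: mem_Collect_eq simp_thms)
    qed
    then show ?thesis using len by (auto simp: chains_def simp del: nth_Cons_Suc)
  qed
  also have "\<dots> \<longleftrightarrow> sorted_wrt ?R ?z"
    unfolding sorted_wrt_iff_nth_Suc_transp[OF tr] using len by (auto simp: encode_def)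
  also have "\<dots> \<longleftrightarrow> (\<forall>x\<in>set (encode t a). (- int k, 0) < x) \<and> sorted_wrt ?R (encode t a)"
    by auto
  also have "(\<forall>x\<in>set (encode t a). (- int k, 0) < x) \<longleftrightarrow> set (encode t a) \<subseteq> alphabet r k"
  proof -
    have "fst x \<le> 0 \<and> 1 \<le> \<bar>snd x\<bar> \<and> \<bar>snd x\<bar> \<le> int r" if "x \<in> set (encode t a)" for x
    proof -
      obtain u s where x: "x = (u, s)" by fastforce
      have "u \<in> set (map (\<lambda>c. - int c) a)" "s \<in> set t"
        using that set_zip_leftD set_zip_rightD unfolding x encode_def by fast+
      then show ?thesis using t[of s] by (auto simp: x)
    qed
    then show ?thesis by (auto simp: alphabet_def)
  qed
  finally show ?thesis .
qed

lemma signed_word_letters: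
  assumes "\<forall>j. length (filter (\<lambda>s. nat \<bar>s\<bar> = j) t) = letter_count \<eta> j" and "s \<in> set t"
  shows "1 \<le> \<bar>s\<bar> \<and> \<bar>s\<bar> \<le> int (length \<eta>)"
proof -
  have "filter (\<lambda>u. nat \<bar>u\<bar> = nat \<bar>s\<bar>) t \<noteq> []" using assms(2) by (auto simp: filter_empty_conv)
  then have "letter_count \<eta> (nat \<bar>s\<bar>) \<noteq> 0" using assms(1) by (metis length_0_conv)
  then show ?thesis by (auto simp: letter_count_def split: if_splits)
qed

definition decode_word :: "int list \<Rightarrow> nat list \<times> int list" where
  "decode_word t = (map (\<lambda>s. nat \<bar>s\<bar>) t, map sgn t)"

lemma length_filter_abs:
  "length (filter (\<lambda>s. nat \<bar>s\<bar> = j) t) = count_list (map (\<lambda>s. nat \<bar>s\<bar>) t) j"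
  by (induction t) auto

lemma decode_signed_word:
  assumes "x \<in> B_eta \<eta>"
  shows "decode_word (signed_word x) = x"
    and "\<forall>j. length (filter (\<lambda>s. nat \<bar>s\<bar> = j) (signed_word x)) = letter_count \<eta> j"
proof -
  obtain w \<epsilon> where x: "x = (w, \<epsilon>)" by fastforce
  have w: "w \<in> S_eta \<eta>" and len: "length \<epsilon> = length w" and sg: "set \<epsilon> \<subseteq> {1, -1}"
    using assms by (auto simp: x B_eta_def)
  have sgn: "\<epsilon> ! i = 1 \<or> \<epsilon> ! i = -1" if "i < length w" for i
    using subsetD[OF sg nth_mem[of i \<epsilon>]] len that by auto
  have pos: "0 < w ! i" if "i < length w" for i
    using S_eta_letter(1)[OF w, of "w ! i"] that by auto
  have abs: "map (\<lambda>s. nat \<bar>s\<bar>) (signed_word x) = w"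
  proof (rule nth_equalityI)
    fix i assume "i < length (map (\<lambda>s. nat \<bar>s\<bar>) (signed_word x))"
    then have i: "i < length w" using len by (simp add: x signed_word_def)
    show "map (\<lambda>s. nat \<bar>s\<bar>) (signed_word x) ! i = w ! i"
      using sgn[OF i] i len by (auto simp: x signed_word_def)
  qed (simp add: x signed_word_def len)
  moreover have "map sgn (signed_word x) = \<epsilon>"
  proof (rule nth_equalityI)
    fix i assume "i < length (map sgn (signed_word x))"
    then have i: "i < length w" using len by (simp add: x signed_word_def)
    show "map sgn (signed_word x) ! i = \<epsilon> ! i"
      using sgn[OF i] pos[OF i] i len by (auto simp: x signed_word_def)
  qed (simp add: x signed_word_def len)
  ultimately show "decode_word (signed_word x) = x" by (simp add: decode_word_def x)
  show "\<forall>j. length (filter (\<lambda>s. nat \<bar>s\<bar> = j) (signed_word x)) = letter_count \<eta> j"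
    using w by (simp add: length_filter_abs abs S_eta_iff)
qed

lemma signed_word_decode:
  assumes "\<forall>j. length (filter (\<lambda>s. nat \<bar>s\<bar> = j) t) = letter_count \<eta> j"
  shows "signed_word (decode_word t) = t" and "decode_word t \<in> B_eta \<eta>"
proof -
  show "signed_word (decode_word t) = t"
    by (rule nth_equalityI) (auto simp: signed_word_def decode_word_def sgn_mult_abs)
  have "set (map sgn t) \<subseteq> {1, -1}"
    using signed_word_letters[OF assms] by (fastforce simp: sgn_if)
  then show "decode_word t \<in> B_eta \<eta>"
    using assms by (simp add: B_eta_def decode_word_def S_eta_iff length_filter_abs)
qed

text \<open>\<open>encode\<close> is a bijection: the second components recover the signed word and
  the negated first ones the chain, whose weight is multiplicative over its entries.\<close>

lemma sum_signed_words:
  "(\<Sum>x\<in>B_eta \<eta>. \<Sum>a\<in>chains (sum_list \<eta>) (Des \<eta> x) k. qv ^ sum_list a) =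
   (\<Sum>xs\<in>sorted_words (\<lambda>x. 0 < snd x) (\<lambda>x. nat \<bar>snd x\<bar>) (alphabet (length \<eta>) k) (letter_count \<eta>).
      \<Prod>x\<leftarrow>xs. qv ^ nat (- fst x))" (is "_ = sum _ ?W")
proof -
  have filter_snd: "length (filter (\<lambda>x. nat \<bar>snd x\<bar> = j) xs) =
      length (filter (\<lambda>s. nat \<bar>s\<bar> = j) (map snd xs))" for j and xs :: "(int \<times> int) list"
    by (simp add: filter_map o_def)
  let ?S = "Sigma (B_eta \<eta>) (\<lambda>x. chains (sum_list \<eta>) (Des \<eta> x) k)"
  have "(\<Sum>x\<in>B_eta \<eta>. \<Sum>a\<in>chains (sum_list \<eta>) (Des \<eta> x) k. qv ^ sum_list a) =
      (\<Sum>(x, a)\<in>?S. qv ^ sum_list a)"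
    by (rule sum.Sigma) (auto simp: finite_B_eta finite_chains)
  also have "\<dots> = (\<Sum>xs\<in>?W. \<Prod>x\<leftarrow>xs. qv ^ nat (- fst x))"
  proof (rule sum.reindex_bij_witness[of _
      "\<lambda>xs. (decode_word (map snd xs), map (\<lambda>x. nat (- fst x)) xs)"
      "\<lambda>(x, a). encode (signed_word x) a"])
    fix p assume "p \<in> ?S"
    then obtain x a where p: "p = (x, a)" and x: "x \<in> B_eta \<eta>"
      and a: "a \<in> chains (sum_list \<eta>) (Des \<eta> x) k" by auto
    let ?t = "signed_word x"
    have len: "length a = length ?t" using a x by (simp add: chains_def length_signed_word)
    have snd: "map snd (encode ?t a) = ?t" using len by (simp add: encode_def)
    have "map fst (encode ?t a) = map (\<lambda>c. - int c) a" using len by (simp add: encode_def)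
    then have "map (\<lambda>u. nat (- u)) (map fst (encode ?t a)) = a" by (simp add: o_def)
    then have fst: "map (\<lambda>x. nat (- fst x)) (encode ?t a) = a" by (simp add: o_def)
    have "\<forall>j. length (filter (\<lambda>x. nat \<bar>snd x\<bar> = j) (encode ?t a)) = letter_count \<eta> j"
      unfolding filter_snd snd by (rule decode_signed_word(2)[OF x])
    then show "(case p of (x, a) \<Rightarrow> encode (signed_word x) a) \<in> ?W"
      using chains_iff_sorted[OF len signed_word_letters[OF decode_signed_word(2)[OF x]], of k] a x
      by (simp add: p sorted_words_def length_signed_word Des_eq_word_descents)
    show "(decode_word (map snd (case p of (x, a) \<Rightarrow> encode (signed_word x) a)),
        map (\<lambda>x. nat (- fst x)) (case p of (x, a) \<Rightarrow> encode (signed_word x) a)) = p"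
      by (simp add: p snd fst decode_signed_word(1)[OF x])
    have "(\<Prod>x\<leftarrow>xs. qv ^ nat (- fst x)) = qv ^ sum_list (map (\<lambda>x. nat (- fst x)) xs)"
      for xs :: "(int \<times> int) list"
      by (induction xs) (simp_all add: power_add)
    then show "(\<Prod>x\<leftarrow>(case p of (x, a) \<Rightarrow> encode (signed_word x) a). qv ^ nat (- fst x)) =
        (case p of (x, a) \<Rightarrow> qv ^ sum_list a)"
      by (simp add: p fst)
  next
    fix xs assume xs: "xs \<in> ?W"
    let ?t = "map snd xs" and ?a = "map (\<lambda>x. nat (- fst x)) xs"
    have t: "\<forall>j. length (filter (\<lambda>s. nat \<bar>s\<bar> = j) ?t) = letter_count \<eta> j"
      using xs by (simp add: sorted_words_def filter_snd del: length_map)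
    have neg: "fst x \<le> 0" if "x \<in> set xs" for x
      using xs that by (auto simp: sorted_words_def alphabet_def)
    \<comment> \<open>The first components are not positive, so \<open>nat\<close> loses
      nothing.\<close>
    have enc: "encode ?t ?a = xs"
      by (rule nth_equalityI) (use neg in \<open>auto simp: encode_def\<close>)
    have x: "decode_word ?t \<in> B_eta \<eta>" "signed_word (decode_word ?t) = ?t"
      using signed_word_decode[OF t] by auto
    have len: "length ?t = sum_list \<eta>" using length_signed_word[OF x(1)] by (simp add: x)
    have "?a \<in> chains (length ?t) (word_descents ?t) k"
      using chains_iff_sorted[of ?a ?t, OF _ signed_word_letters[OF t], of k] xs
      by (simp add: enc sorted_words_def)
    then show "(decode_word ?t, ?a) \<in> ?S"
      using x len by (simp add: Des_eq_word_descents)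
    show "(case (decode_word ?t, ?a) of (x, a) \<Rightarrow> encode (signed_word x) a) = xs"
      by (simp only: x enc prod.case)
  qed
  finally show ?thesis .
qed

section \<open>Evaluation of the generating functions\<close>

lemma alphabet_colour:
  assumes "1 \<le> j" and "j \<le> r"
  shows "{x \<in> alphabet r k. nat \<bar>snd x\<bar> = j} =
    (\<lambda>a. (- int a, int j)) ` {..k} \<union> (\<lambda>a. (- int a, - int j)) ` {..<k}"
proof (rule set_eqI)
  fix x :: "int \<times> int"
  obtain u s where x: "x = (u, s)" by fastforce
  show "x \<in> {x \<in> alphabet r k. nat \<bar>snd x\<bar> = j} \<longleftrightarrow>
      x \<in> (\<lambda>a. (- int a, int j)) ` {..k} \<union> (\<lambda>a. (- int a, - int j)) ` {..<k}"
  proof (cases "0 \<le> - u")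
    case True
    then obtain c where c: "u = - int c" by (metis minus_minus nonneg_int_cases)
    show ?thesis using assms by (auto simp: x c alphabet_def image_iff)
  next
    case False
    then show ?thesis by (auto simp: x alphabet_def)
  qed
qed

lemma finite_alphabet: "finite (alphabet r k)"
proof (rule finite_subset)
  show "alphabet r k \<subseteq> {- int k..0} \<times> {- int r..int r}"
    by (auto simp: alphabet_def less_prod_def')
qed simp

text \<open>The \<open>k + 1\<close> pairs with letter \<open>j\<close> are repeatable and give the
  inverse factors; the \<open>k\<close> pairs with letter \<open>-j\<close> are not and give the
  factors of the numerator.\<close>

lemma letter_fps_alphabet:
  assumes "1 \<le> j" and "j \<le> r"
  shows "(\<Prod>x\<in>{x \<in> alphabet r k. nat \<bar>snd x\<bar> = j}.
      letter_fps (\<lambda>x. 0 < snd x) (\<lambda>x. qv ^ nat (- fst x)) x) = cross_fps k"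
  unfolding alphabet_colour[OF assms] using assms
  by (subst prod.union_disjoint)
     (auto simp: prod.reindex inj_on_def letter_fps_def cross_fps_def mult.commute)

lemma sum_B_eta:
  "(\<Sum>x\<in>B_eta \<eta>. \<Sum>a\<in>chains (sum_list \<eta>) (Des \<eta> x) k. qv ^ sum_list a) =
   (\<Prod>i<length \<eta>. cross_fps k $ (\<eta> ! i))"
proof -
  let ?P = "\<lambda>j. \<Prod>x\<in>{x \<in> alphabet (length \<eta>) k. nat \<bar>snd x\<bar> = j}.
      letter_fps (\<lambda>x. 0 < snd x) (\<lambda>x. qv ^ nat (- fst x)) x"
  have "(\<Sum>x\<in>B_eta \<eta>. \<Sum>a\<in>chains (sum_list \<eta>) (Des \<eta> x) k. qv ^ sum_list a) =
      (\<Prod>j\<in>{1..length \<eta>}. ?P j $ letter_count \<eta> j)"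
    unfolding sum_signed_words
    by (rule sum_sorted_words[THEN conjunct2])
       (auto simp: finite_alphabet letter_count_def, auto simp: alphabet_def)
  also have "\<dots> = (\<Prod>j\<in>{1..length \<eta>}. cross_fps k $ (\<eta> ! (j - 1)))"
    by (rule prod.cong) (simp_all add: letter_fps_alphabet letter_count_def)
  also have "\<dots> = (\<Prod>i<length \<eta>. cross_fps k $ (\<eta> ! i))"
    by (simp add: prod.atLeast1_atMost_eq)
  finally show ?thesis .
qed

text \<open>\<open>chains_fps\<close> with \<open>s = 0\<close> rewrites the term of each signed
  word as its chain series times the common denominator; \<open>sum_B_eta\<close> then evaluates the
  summed series coefficientwise.\<close>

lemma C_B_eq:
  "C_B \<eta> = Abs_fps (\<lambda>k. \<Prod>i<length \<eta>. cross_fps k $ (\<eta> ! i)) *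
     (\<Prod>i = 0..sum_list \<eta>. 1 - fps_const (qv ^ i) * fps_X)" (is "_ = ?G * ?D")
proof -
  let ?F = "\<lambda>x. Abs_fps (\<lambda>k. \<Sum>a\<in>chains (sum_list \<eta>) (Des \<eta> x) k. qv ^ sum_list a)"
  have "C_B \<eta> = (\<Sum>x\<in>B_eta \<eta>. ?F x * ?D)"
    unfolding C_B_def
  proof (rule sum.cong)
    fix x assume x: "x \<in> B_eta \<eta>"
    have sub: "Des \<eta> x \<subseteq> {..<sum_list \<eta>}"
      using x by (auto simp: Des_def B_eta_def length_S_eta)
    have "fps_const (qv ^ maj \<eta> x) * fps_X ^ des \<eta> x = (\<Prod>i\<in>Des \<eta> x. fps_const (qv ^ i) * fps_X)"
    proof -
      have "(\<Prod>i\<in>D. fps_const (qv ^ i)) = fps_const (\<Prod>i\<in>D. qv ^ i)" for D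
        by (induction D rule: infinite_finite_induct) auto
      then show ?thesis by (simp add: prod.distrib maj_def des_def power_sum)
    qed
    also have "\<dots> = ?F x * ?D" using chains_fps[OF sub, of qv 0] by simp
    finally show "fps_const (qv ^ maj \<eta> x) * fps_X ^ des \<eta> x = ?F x * ?D" .
  qed simp
  also have "\<dots> = (\<Sum>x\<in>B_eta \<eta>. ?F x) * ?D" by (simp add: sum_distrib_right)
  also have "(\<Sum>x\<in>B_eta \<eta>. ?F x) = ?G"
    by (rule fps_ext) (simp add: fps_sum_nth sum_B_eta)
  finally show ?thesis .
qed

theorem theorem3p2:
  fixes \<eta> :: "nat list" and n :: nat
  assumes "\<forall>m\<in>set \<eta>. 0 < m" and "sum_list \<eta> = n"
  shows "C_B \<eta> / (\<Prod>i = 0..n. 1 - fps_const (qv ^ i) * fps_X)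
           = Abs_fps (\<lambda>k. \<Prod>i<length \<eta>. \<Sum>j = 0..\<eta> ! i.
               qv ^ (j * (j - 1) div 2) * q_binom (\<eta> ! i) j * q_binom (k + \<eta> ! i - j) (\<eta> ! i))
       \<and> Abs_fps (\<lambda>k. \<Prod>i<length \<eta>. \<Sum>j = 0..\<eta> ! i.
               qv ^ (j * (j - 1) div 2) * q_binom (\<eta> ! i) j * q_binom (k + \<eta> ! i - j) (\<eta> ! i))
           = Ehr \<eta>"
proof -
  \<comment> \<open>Every factor has constant coefficient 1, so the denominator is non-zero and can
    be cancelled.\<close>
  have "1 - fps_const c * fps_X \<noteq> (0 :: rat poly fract fps)" for c
  proof
    assume "1 - fps_const c * fps_X = (0 :: rat poly fract fps)"
    then have "(1 - fps_const c * fps_X) $ 0 = (0 :: rat poly fract fps) $ 0" by (rule arg_cong)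
    then show False by simp
  qed
  then have "(\<Prod>i = 0..n. 1 - fps_const (qv ^ i) * fps_X) \<noteq> 0" by simp
  then have "C_B \<eta> / (\<Prod>i = 0..n. 1 - fps_const (qv ^ i) * fps_X) =
      Abs_fps (\<lambda>k. \<Prod>i<length \<eta>. cross_fps k $ (\<eta> ! i))"
    unfolding C_B_eq assms(2) by (rule nonzero_mult_div_cancel_right)
  then show ?thesis unfolding Ehr_eq cross_fps_nth by simp
qed

end
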